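(* Let $f\colon\mathbb{R}^J\to\left]-\infty,+\infty\right]$ be a convex function of Legendre type, let $U=\operatorname{int}\operatorname{dom} f$, and let $C$ be a nonempty compact subset of $U$. Then $\overrightarrow{F}_C$ has a unique minimizer, it lies in $\operatorname{dom} f$ (it is called the $\overrightarrow{D}$-Chebyshev center of $C$), and it is characterized as follows: a point $x\in\operatorname{dom} f$ is the minimizer of $\overrightarrow{F}_C$ if and only if $$x\in\nabla f^*\Big(\operatorname{conv}\,\nabla f\big(\overrightarrow{Q}_C(x)\big)\Big).$$
   Context: $\mathbb{R}^J$ is the standard Euclidean space with inner product $\langle\cdot,\cdot\rangle$ and norm $\|\cdot\|$; $\operatorname{dom} g=\{x: g(x)\in\mathbb{R}\}$; $\operatorname{conv}$ denotes the convex hull. A proper lower semicontinuous convex function $g\colon\mathbb{R}^J\to\left]-\infty,+\infty\right]$ with $\operatorname{int}\operatorname{dom} g\neq\varnothing$ is essentially smooth if $g$ is differentiable on $\operatorname{int}\operatorname{dom} g$ and $\|\nabla g(x)\|\to+\infty$ whenever $x\in\operatorname{int}\operatorname{dom} g$ approaches a point of the boundary of $\operatorname{dom} g$; it is essentially strictly convex if it is strictly convex on every convex subset of $\operatorname{dom}\partial g=\{x:\partial g(x)\neq\varnothing\}$, where $\partial g$ is the convex subdifferential; it is of Legendre type if it is both. $f^*$ is the Fenchel conjugate of $f$. It is known (Rockafellar) that $f^*$ is also of Legendre type and that $\nabla f\colon U\to\operatorname{int}\operatorname{dom} f^*$ is a continuous bijection with continuous inverse $\nabla f^*$. For sets $S\subseteq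 U$ and $T\subseteq\operatorname{int}\operatorname{dom} f^*$, $\nabla f(S)$ and $\nabla f^*(T)$ denote images. The Bregman distance $D\colon\mathbb{R}^J\times\mathbb{R}^J\to[0,+\infty]$ of $f$ is $D(x,y)=f(x)-f(y)-\langle\nabla f(y),x-y\rangle$ if $y\in U$, and $D(x,y)=+\infty$ otherwise. For $\varnothing\neq C\subseteq U$, the right Bregman farthest-distance function is $\overrightarrow{F}_C(x)=\sup_{c\in C}D(x,c)$ for $x\in\mathbb{R}^J$, and the right Bregman farthest-point map is the set-valued map with $\overrightarrow{Q}_C(x)=\{c\in C: D(x,c)=\overrightarrow{F}_C(x)\}$ if $x\in\operatorname{dom} f$, and $\overrightarrow{Q}_C(x)=\varnothing$ otherwise. *)

theory Defs
  imports "HOL-Analysis.Analysis"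
begin

definition edom :: "('a \<Rightarrow> ereal) \<Rightarrow> 'a set" where
  "edom g = {x. \<bar>g x\<bar> \<noteq> \<infinity>}"

definition proper_fun :: "('a \<Rightarrow> ereal) \<Rightarrow> bool" where
  "proper_fun g \<longleftrightarrow> (\<forall>x. g x \<noteq> -\<infinity>) \<and> (\<exists>x. g x \<noteq> \<infinity>)"

definition lsc_fun :: "('a::topological_space \<Rightarrow> ereal) \<Rightarrow> bool" where
  "lsc_fun g \<longleftrightarrow> (\<forall>x. g x \<le> Liminf (at x) g)"

text \<open>The two convexity notions below are only used for functions that never take the
  value \<^term>\<open>-\<infinity> :: ereal\<close>, so the sums on the right are never of the
  form \<^term>\<open>\<infinity> + (-\<infinity>) :: ereal\<close>.\<close>

definition convex_fun :: "('a::real_vector \<Rightarrow> ereal) \<Rightarrow> bool" where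
  "convex_fun g \<longleftrightarrow> (\<forall>x y. \<forall>t::real. 0 < t \<longrightarrow> t < 1 \<longrightarrow>
     g ((1 - t) *\<^sub>R x + t *\<^sub>R y) \<le> ereal (1 - t) * g x + ereal t * g y)"

definition strictly_convex_fun_on :: "'a::real_vector set \<Rightarrow> ('a \<Rightarrow> ereal) \<Rightarrow> bool" where
  "strictly_convex_fun_on S g \<longleftrightarrow> (\<forall>x\<in>S. \<forall>y\<in>S. \<forall>t::real. x \<noteq> y \<longrightarrow> 0 < t \<longrightarrow> t < 1 \<longrightarrow>
     g ((1 - t) *\<^sub>R x + t *\<^sub>R y) < ereal (1 - t) * g x + ereal t * g y)"

definition subdiff :: "('a::real_inner \<Rightarrow> ereal) \<Rightarrow> 'a \<Rightarrow> 'a set" where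
  "subdiff g x = {v. \<forall>y. g x + ereal (inner v (y - x)) \<le> g y}"

text \<open>Differentiability and gradients are only considered at points of the interior of
  \<^term>\<open>edom g\<close>. There \<^term>\<open>\<lambda>y. real_of_ereal (g y)\<close> agrees with \<^term>\<open>g\<close> near the point,
  so the value 0 which it takes outside \<^term>\<open>edom g\<close> plays no role.\<close>

definition grad :: "('a::real_inner \<Rightarrow> ereal) \<Rightarrow> 'a \<Rightarrow> 'a" where
  "grad g x = (THE v. GDERIV (\<lambda>y. real_of_ereal (g y)) x :> v)"

definition essentially_smooth :: "('a::euclidean_space \<Rightarrow> ereal) \<Rightarrow> bool" where
  "essentially_smooth g \<longleftrightarrow>
     (\<forall>x\<in>interior (edom g). (\<lambda>y. real_of_ereal (g y)) differentiable (at x)) \<and>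
     (\<forall>z\<in>frontier (edom g).
        filterlim (\<lambda>x. norm (grad g x)) at_top (at z within interior (edom g)))"

definition essentially_strictly_convex :: "('a::euclidean_space \<Rightarrow> ereal) \<Rightarrow> bool" where
  "essentially_strictly_convex g \<longleftrightarrow>
     (\<forall>S. convex S \<longrightarrow> S \<subseteq> {x. subdiff g x \<noteq> {}} \<longrightarrow> strictly_convex_fun_on S g)"

text \<open>The standing assumptions under which essential smoothness and essential strict convexity
  are meaningful (proper, lower semicontinuous, convex, domain with nonempty interior)
  are collected here.\<close>

definition legendre_type :: "('a::euclidean_space \<Rightarrow> ereal) \<Rightarrow> bool" where
  "legendre_type g \<longleftrightarrow>
     proper_fun g \<and> lsc_fun g \<and> convex_fun g \<and> interior (edom g) \<noteq> {} \<and>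
     essentially_smooth g \<and> essentially_strictly_convex g"

definition fenchel_conj :: "('a::real_inner \<Rightarrow> ereal) \<Rightarrow> 'a \<Rightarrow> ereal" where
  "fenchel_conj g u = (SUP x. ereal (inner u x) - g x)"

definition bregman :: "('a::euclidean_space \<Rightarrow> ereal) \<Rightarrow> 'a \<Rightarrow> 'a \<Rightarrow> ereal" where
  "bregman f x y =
     (if y \<in> interior (edom f) then f x - f y - ereal (inner (grad f y) (x - y)) else \<infinity>)"

definition right_farthest_dist ::
    "('a::euclidean_space \<Rightarrow> ereal) \<Rightarrow> 'a set \<Rightarrow> 'a \<Rightarrow> ereal" where
  "right_farthest_dist f C x = (SUP c\<in>C. bregman f x c)"

definition right_farthest_points ::
    "('a::euclidean_space \<Rightarrow> ereal) \<Rightarrow> 'a set \<Rightarrow> 'a \<Rightarrow> 'a set" where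
  "right_farthest_points f C x =
     (if x \<in> edom f then {c\<in>C. bregman f x c = right_farthest_dist f C x} else {})"

definition is_minimizer :: "('a \<Rightarrow> ereal) \<Rightarrow> 'a \<Rightarrow> bool" where
  "is_minimizer g x \<longleftrightarrow> (\<forall>y. g x \<le> g y)"

end

theory Submission
  imports Defs
begin

text \<open>
  Write \<open>D (x, c) = f x + \<psi> c - \<langle>\<nabla>f c, x\<rangle>\<close> with \<open>\<psi> c = \<langle>\<nabla>f c, c\<rangle> - f c\<close>. The farthest distance
  \<open>F\<close> is then \<open>f\<close> plus the maximum over \<open>c \<in> C\<close> of affine functions of \<open>x\<close>; the maximum is finite
  and attained because the gradient of \<open>f\<close> is continuous and \<open>C\<close> is compact. A point \<open>x\<close> of
  the domain minimizes \<open>F\<close> iff zero is a subgradient of \<open>F\<close> at \<open>x\<close>, that is, iff some \<open>u\<close> in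
  the convex hull of the gradients at the farthest points of \<open>x\<close> is a subgradient of \<open>f\<close> at \<open>x\<close>.
  By conjugacy the latter says that \<open>x = \<nabla>f* u\<close>.

  Conjugacy (\<open>grad_fenchel_conj\<close>) comes from essential strict convexity: if \<open>u\<close> is a subgradient of
  \<open>f\<close> at \<open>x0\<close>, then \<open>x0\<close> is the only minimizer of \<open>f - \<langle>u, \<cdot>\<rangle>\<close>, so this function grows
  linearly away from \<open>x0\<close> (\<open>subdiff_linear_growth\<close>), and linear growth forces the conjugate to be
  differentiable at \<open>u\<close> with gradient \<open>x0\<close>. Applied to \<open>u = \<nabla>f c\<close>, the same growth makes
  \<open>D (\<cdot>, c)\<close>, and hence \<open>F\<close>, coercive, so that \<open>F\<close> has a minimizer. It also shows that
  every element \<open>u\<close> of the convex hull is a subgradient of \<open>f\<close> somewhere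
  (\<open>coercive_slope_in_subdiff\<close>).

  Sufficiency of the condition is elementary: each farthest point \<open>c\<close> gives
  \<open>F y - F x \<ge> f y - f x - \<langle>\<nabla>f c, y - x\<rangle>\<close>, the bound extends to the convex hull, and it is
  positive for \<open>y \<noteq> x\<close> if \<open>u\<close> is a subgradient at \<open>x\<close> (\<open>right_farthest_dist_strict_min\<close>).
  The strictness also yields uniqueness. For necessity, moving from a minimizer towards a point
  \<open>y\<close> and passing to the limit in the active pieces gives a farthest point \<open>c\<close>, depending on
  \<open>y\<close>, with \<open>\<langle>\<nabla>f c, y - x\<rangle> \<le> f y - f x\<close> (\<open>active_piece_in_direction\<close>); a separating
  hyperplane then provides one \<open>u\<close> in the convex hull for all \<open>y\<close> (\<open>uniform_subgradient\<close>).
\<close>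

section \<open>Lower semicontinuous functions\<close>

lemma closed_sublevel_add_continuous:
  fixes f :: "'a::t2_space \<Rightarrow> ereal" and l :: "'a \<Rightarrow> real"
  assumes lsc: "lsc_fun f" and cont: "continuous_on UNIV l"
  shows "closed {x. f x + ereal (l x) \<le> a}"
proof -
  have "open {x. a < f x + ereal (l x)}"
  proof (subst open_subopen, safe)
    fix x assume ax: "a < f x + ereal (l x)"
    then have "a - ereal (l x) < f x"
      by (simp add: ereal_minus_less)
    then obtain s where s: "a - ereal (l x) < s" "s < f x"
      using dense by blast
    have "a < s + ereal (l x)"
      using s by (simp add: ereal_minus_less)
    moreover have "((\<lambda>y. s + ereal (l y)) \<longlongrightarrow> s + ereal (l x)) (at x)"
      using cont by (cases s) (auto simp: continuous_on_def intro!: tendsto_intros)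
    ultimately have 1: "eventually (\<lambda>y. a < s + ereal (l y)) (at x)"
      by (rule order_tendstoD(1)[rotated])
    have "s < Liminf (at x) f"
      using s(2) lsc by (auto simp: lsc_fun_def intro: less_le_trans)
    then have 2: "eventually (\<lambda>y. s < f y) (at x)"
      by (rule less_LiminfD)
    from 1 2 have "eventually (\<lambda>y. a < f y + ereal (l y)) (at x)"
      by eventually_elim (metis add_right_mono less_imp_le less_le_trans)
    then obtain T where T: "open T" "x \<in> T" "\<forall>y\<in>T. y \<noteq> x \<longrightarrow> a < f y + ereal (l y)"
      unfolding eventually_at_topological by auto
    then have "T \<subseteq> {x. a < f x + ereal (l x)}"
      using ax by auto
    with T show "\<exists>T. open T \<and> x \<in> T \<and> T \<subseteq> {x. a < f x + ereal (l x)}"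
      by blast
  qed
  then show ?thesis
    by (simp add: closed_def Collect_neg_eq[symmetric] not_le)
qed

text \<open>The sets \<open>{x \<in> K. g x \<le> g y}\<close> for \<open>y \<in> K\<close> form a chain of nonempty compact
  sets; a common point is a minimizer.\<close>

lemma closed_sublevels_attain_min:
  fixes g :: "'a::t2_space \<Rightarrow> ereal"
  assumes cl: "\<And>a. closed {x. g x \<le> a}" and K: "compact K" "K \<noteq> {}"
  shows "\<exists>x\<in>K. \<forall>y\<in>K. g x \<le> g y"
proof -
  have "K \<inter> \<Inter>((\<lambda>y. {x. g x \<le> g y}) ` K) \<noteq> {}"
  proof (rule compact_imp_fip[OF K(1)])
    show "closed T" if "T \<in> (\<lambda>y. {x. g x \<le> g y}) ` K" for T
      using that cl by auto
    fix \<F>' assume fin: "finite \<F>'" and sub: "\<F>' \<subseteq> (\<lambda>y. {x. g x \<le> g y}) ` K"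
    then obtain Y where Y: "Y \<subseteq> K" "finite Y" "\<F>' = (\<lambda>y. {x. g x \<le> g y}) ` Y"
      by (meson finite_subset_image)
    show "K \<inter> \<Inter>\<F>' \<noteq> {}"
    proof (cases "Y = {}")
      case False
      then obtain z where "z \<in> Y" "\<forall>y\<in>Y. g z \<le> g y"
        using Y(2) by (metis arg_min_if_finite(1) arg_min_least)
      then show ?thesis using Y by auto
    qed (use K Y in auto)
  qed
  then show ?thesis by auto
qed

lemma coercive_attains_min:
  fixes g :: "'a::euclidean_space \<Rightarrow> ereal"
  assumes cl: "\<And>a. closed {x. g x \<le> a}"
    and fin: "g x0 \<noteq> \<infinity>"
    and k: "0 < k" and coer: "\<And>x. ereal (k * norm x - b) \<le> g x"
  shows "\<exists>x. is_minimizer g x"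
proof -
  obtain q where q: "g x0 = ereal q"
    using fin coer[of x0] by (cases "g x0") auto
  define R where "R = max (norm x0) ((q + b) / k)"
  have "cball (0::'a) R \<noteq> {}" and x0: "x0 \<in> cball 0 R"
    by (auto simp: R_def)
  then obtain x where x: "x \<in> cball 0 R" "\<forall>y\<in>cball 0 R. g x \<le> g y"
    using closed_sublevels_attain_min[OF cl compact_cball] by blast
  have "g x \<le> g y" for y
  proof (cases "y \<in> cball 0 R")
    case False
    then have "(q + b) / k < norm y" by (auto simp: R_def)
    then have "q \<le> k * norm y - b" using k by (simp add: field_simps)
    then have "g x0 \<le> g y" using coer[of y] q by (metis ereal_less_eq(3) order_trans)
    then show ?thesis using x x0 order_trans by blast
  qed (use x in auto)
  then show ?thesis by (auto simp: is_minimizer_def)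
qed

section \<open>Linear growth around a strict minimizer\<close>

lemma convex_funD:
  assumes "convex_fun f" and "0 < t" and "t < 1"
  shows "f ((1 - t) *\<^sub>R x + t *\<^sub>R y) \<le> ereal (1 - t) * f x + ereal t * f y"
  using assms by (simp add: convex_fun_def)

lemma convex_fun_add_affine:
  fixes f :: "'a::real_inner \<Rightarrow> ereal"
  assumes conv: "convex_fun f" and proper: "proper_fun f"
  shows "convex_fun (\<lambda>x. f x + ereal (inner v x + b))"
  unfolding convex_fun_def
proof (intro allI impI)
  fix x y :: 'a and t :: real
  assume t: "0 < t" "t < 1"
  have le: "f ((1 - t) *\<^sub>R x + t *\<^sub>R y) \<le> ereal (1 - t) * f x + ereal t * f y"
    using convex_funD[OF conv t] .
  have "f x \<noteq> -\<infinity>" "f y \<noteq> -\<infinity>" "f ((1 - t) *\<^sub>R x + t *\<^sub>R y) \<noteq> -\<infinity>"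
    using proper by (auto simp: proper_fun_def)
  then show "f ((1 - t) *\<^sub>R x + t *\<^sub>R y) + ereal (inner v ((1 - t) *\<^sub>R x + t *\<^sub>R y) + b)
      \<le> ereal (1 - t) * (f x + ereal (inner v x + b)) + ereal t * (f y + ereal (inner v y + b))"
    using le t
    by (cases "f x"; cases "f y"; cases "f ((1 - t) *\<^sub>R x + t *\<^sub>R y)")
       (auto simp: inner_add_right algebra_simps)
qed

text \<open>On a sphere around the minimizer the function has a positive lower bound, and convexity
  along rays from the minimizer turns it into linear growth outside the sphere.\<close>

lemma linear_growth_strict_min:
  fixes g :: "'a::euclidean_space \<Rightarrow> ereal"
  assumes conv: "convex_fun g" and cl: "\<And>a. closed {x. g x \<le> a}"
    and zero: "g x0 = 0" and pos: "\<And>x. x \<noteq> x0 \<Longrightarrow> 0 < g x" and e: "0 < e"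
  shows "\<exists>k>0. \<forall>x. e \<le> norm (x - x0) \<longrightarrow> ereal (k * norm (x - x0)) \<le> g x"
proof -
  have "sphere x0 e \<noteq> {}" using e by simp
  then obtain z where z: "z \<in> sphere x0 e" "\<forall>y\<in>sphere x0 e. g z \<le> g y"
    using closed_sublevels_attain_min[OF cl compact_sphere] by blast
  have "0 < g z" using z(1) e pos by (metis centre_in_cball dist_self less_irrefl mem_sphere)
  then obtain m where m: "0 < ereal m" "ereal m < g z"
    using ereal_dense2 by blast
  then have m0: "0 < m" by simp
  have "ereal (m / e * norm (x - x0)) \<le> g x" if x: "e \<le> norm (x - x0)" for x
  proof -
    define r where "r = norm (x - x0)"
    define t where "t = e / r"
    have r: "e \<le> r" "0 < r" using x e by (auto simp: r_def)
    define y where "y = (1 - t) *\<^sub>R x0 + t *\<^sub>R x"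
    have "y - x0 = t *\<^sub>R (x - x0)" by (simp add: y_def algebra_simps)
    then have "norm (y - x0) = e" using r e by (simp add: t_def r_def)
    then have "y \<in> sphere x0 e" by (simp add: dist_norm norm_minus_commute)
    then have my: "ereal m < g y" using z m by (meson less_le_trans)
    have t: "0 < t" "t \<le> 1" using r e by (auto simp: t_def)
    have "g y \<le> ereal t * g x"
    proof (cases "t = 1")
      case False
      then show ?thesis
        using convex_funD[OF conv, of t x0 x] t zero by (simp add: y_def)
    qed (simp add: y_def)
    with my have "ereal m < ereal t * g x" by simp
    then have "ereal (m / t) \<le> g x"
      using t by (cases "g x") (auto simp: field_simps)
    then show ?thesis using e r by (simp add: t_def r_def)
  qed
  then show ?thesis using m0 e by (intro exI[of _ "m / e"]) auto
qed

section \<open>Subgradients of Legendre functions\<close>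

lemma subdiffD:
  "u \<in> subdiff f x \<Longrightarrow> f x + ereal (inner u (y - x)) \<le> f y"
  by (simp add: subdiff_def)

lemma subdiff_imp_finite:
  assumes "proper_fun f" and "u \<in> subdiff f x"
  obtains a where "f x = ereal a"
proof -
  obtain y where "f y \<noteq> \<infinity>" using assms(1) by (auto simp: proper_fun_def)
  moreover have "f x + ereal (inner u (y - x)) \<le> f y" using assms(2) by (simp add: subdiff_def)
  moreover have "f x \<noteq> -\<infinity>" using assms(1) by (simp add: proper_fun_def)
  ultimately show thesis using that by (cases "f x") auto
qed

text \<open>The points with a common subgradient \<open>u\<close> form a convex set on which \<open>f\<close> is affine with
  slope \<open>u\<close>; strict convexity leaves room for one such point only.\<close>

lemma subdiff_inj:
  fixes f :: "'a::euclidean_space \<Rightarrow> ereal"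
  assumes f: "legendre_type f" and x: "u \<in> subdiff f x" and y: "u \<in> subdiff f y"
  shows "x = y"
proof (rule ccontr)
  assume "x \<noteq> y"
  have proper: "proper_fun f" and conv: "convex_fun f" and str: "essentially_strictly_convex f"
    using f by (auto simp: legendre_type_def)
  define S where "S = {z. u \<in> subdiff f z}"
  have "convex S"
    unfolding convex_alt
  proof (intro ballI allI impI)
    fix p q and t :: real
    assume p: "p \<in> S" and q: "q \<in> S" and t: "0 \<le> t \<and> t \<le> 1"
    show "(1 - t) *\<^sub>R p + t *\<^sub>R q \<in> S"
    proof (cases "t = 0 \<or> t = 1")
      case False
      with t have t: "0 < t" "t < 1" by auto
      obtain a where a: "f p = ereal a"
        using p proper S_def subdiff_imp_finite by blast
      obtain b where b: "f q = ereal b"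
        using q proper S_def subdiff_imp_finite by blast
      have le: "f ((1 - t) *\<^sub>R p + t *\<^sub>R q) \<le> ereal ((1 - t) * a + t * b)"
        using convex_funD[OF conv t, of p q] a b by simp
      have "f ((1 - t) *\<^sub>R p + t *\<^sub>R q) + ereal (inner u (w - ((1 - t) *\<^sub>R p + t *\<^sub>R q))) \<le> f w" for w
      proof (cases "f w")
        case (real c)
        have 1: "a + inner u (w - p) \<le> c" "b + inner u (w - q) \<le> c"
          using subdiffD[of u f p w] subdiffD[of u f q w] p q a b real by (auto simp: S_def)
        have "(1 - t) * (a + inner u (w - p)) + t * (b + inner u (w - q)) \<le> (1 - t) * c + t * c"
          using 1 t by (intro add_mono mult_left_mono) auto
        then have "(1 - t) * a + t * b + inner u (w - ((1 - t) *\<^sub>R p + t *\<^sub>R q)) \<le> c"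
          by (simp add: inner_diff_right inner_add_right algebra_simps)
        then show ?thesis
          using le real by (cases "f ((1 - t) *\<^sub>R p + t *\<^sub>R q)") auto
      qed (use proper in \<open>auto simp: proper_fun_def\<close>)
      then show ?thesis by (simp add: S_def subdiff_def)
    qed (use p q in auto)
  qed
  moreover have "S \<subseteq> {z. subdiff f z \<noteq> {}}" by (auto simp: S_def)
  ultimately have "strictly_convex_fun_on S f"
    using str by (auto simp: essentially_strictly_convex_def)
  then have lt: "f ((1 - 1/2) *\<^sub>R x + (1/2) *\<^sub>R y) < ereal (1 - 1/2) * f x + ereal (1/2) * f y"
    unfolding strictly_convex_fun_on_def using x y \<open>x \<noteq> y\<close>
    by (elim ballE[of _ _ x] ballE[of _ _ y] allE[of _ "1/2"]) (auto simp: S_def)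
  obtain a where a: "f x = ereal a"
    using x proper subdiff_imp_finite by blast
  obtain b where b: "f y = ereal b"
    using y proper subdiff_imp_finite by blast
  let ?m = "(1 - 1/2) *\<^sub>R x + (1/2::real) *\<^sub>R y"
  have mx: "?m - x = (1/2) *\<^sub>R (y - x)" by (simp add: algebra_simps flip: scaleR_add_left)
  have "f x + ereal (inner u (?m - x)) \<le> f ?m" "f y + ereal (inner u (x - y)) \<le> f x"
    "f x + ereal (inner u (y - x)) \<le> f y"
    using x y by (blast intro: subdiffD)+
  then show False
    using lt a b unfolding mx
    by (cases "f ?m") (auto simp: inner_diff_right algebra_simps)
qed

lemma subdiff_linear_growth:
  fixes f :: "'a::euclidean_space \<Rightarrow> ereal"
  assumes f: "legendre_type f" and u: "u \<in> subdiff f x0" and a: "f x0 = ereal a" and e: "0 < e"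
  shows "\<exists>k>0. \<forall>x. e \<le> norm (x - x0) \<longrightarrow>
    ereal (a + inner u (x - x0) + k * norm (x - x0)) \<le> f x"
proof -
  have proper: "proper_fun f" and conv: "convex_fun f" and lsc: "lsc_fun f"
    using f by (auto simp: legendre_type_def)
  define g where "g = (\<lambda>x. f x + ereal (inner (- u) x + (inner u x0 - a)))"
  have "convex_fun g"
    unfolding g_def by (rule convex_fun_add_affine[OF conv proper])
  moreover have "closed {x. g x \<le> c}" for c
    unfolding g_def by (intro closed_sublevel_add_continuous lsc continuous_intros)
  moreover have "g x0 = 0" by (simp add: g_def a)
  moreover have "0 < g x" if "x \<noteq> x0" for x
  proof (rule ccontr)
    assume "\<not> 0 < g x"
    then obtain b where b: "f x = ereal b" "b \<le> a + inner u (x - x0)"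
      using proper
      by (cases "f x") (auto simp: g_def proper_fun_def not_less inner_diff_right algebra_simps)
    have "f x + ereal (inner u (w - x)) \<le> f w" for w
    proof -
      have "ereal (a + inner u (w - x0)) \<le> f w"
        using subdiffD[OF u, of w] a by simp
      moreover have "b + inner u (w - x) \<le> a + inner u (w - x0)"
        using b(2) by (simp add: inner_diff_right)
      ultimately show ?thesis using b(1)
        by (metis ereal_less_eq(3) order_trans plus_ereal.simps(1))
    qed
    then have "u \<in> subdiff f x" by (simp add: subdiff_def)
    then show False using subdiff_inj[OF f u] that by simp
  qed
  ultimately obtain k where k: "0 < k" "\<And>x. e \<le> norm (x - x0) \<Longrightarrow> ereal (k * norm (x - x0)) \<le> g x"
    using linear_growth_strict_min[of g x0 e] e by blast
  have "ereal (a + inner u (x - x0) + k * norm (x - x0)) \<le> f x" if "e \<le> norm (x - x0)" for x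
    using k(2)[OF that] by (cases "f x") (auto simp: g_def inner_diff_right algebra_simps)
  then show ?thesis using k(1) by blast
qed

lemma grad_eqI:
  assumes "GDERIV (\<lambda>y. real_of_ereal (g y)) x :> v"
  shows "grad g x = v"
  unfolding grad_def
proof (rule the_equality)
  show "GDERIV (\<lambda>y. real_of_ereal (g y)) x :> v" by (rule assms)
  fix w assume "GDERIV (\<lambda>y. real_of_ereal (g y)) x :> w"
  then have "(\<lambda>h. inner h w) = (\<lambda>h. inner h v)"
    using assms unfolding gderiv_def by (rule has_derivative_unique)
  then show "w = v" by (metis inner_commute vector_eq_ldot)
qed

text \<open>With \<open>a = f x0\<close>, the remainder \<open>f* u' - f* u - \<langle>u' - u, x0\<rangle>\<close> is the supremum over \<open>x\<close> of
  \<open>\<langle>u' - u, x - x0\<rangle> - (f x - a - \<langle>u, x - x0\<rangle>)\<close>. It is nonnegative (take \<open>x = x0\<close>). Points with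
  \<open>norm (x - x0) \<le> e\<close> contribute at most \<open>e * norm (u' - u)\<close>, and by linear growth the others
  contribute nothing positive once \<open>u'\<close> is close to \<open>u\<close>.\<close>

lemma grad_fenchel_conj:
  fixes f :: "'a::euclidean_space \<Rightarrow> ereal"
  assumes f: "legendre_type f" and u: "u \<in> subdiff f x0"
  shows "grad (fenchel_conj f) u = x0"
proof (rule grad_eqI)
  have proper: "proper_fun f" using f by (simp add: legendre_type_def)
  obtain a where a: "f x0 = ereal a"
    using subdiff_imp_finite[OF proper u] by blast
  have lower: "ereal (inner w x0 - a) \<le> fenchel_conj f w" for w
    unfolding fenchel_conj_def by (rule SUP_upper2[of x0]) (auto simp: a)
  have sub: "ereal (a + inner u (x - x0)) \<le> f x" for x
    using subdiffD[OF u, of x] a by simp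
  have upper: "\<exists>k>0. \<forall>w. norm (w - u) < k \<longrightarrow>
      fenchel_conj f w \<le> ereal (inner w x0 - a + e * norm (w - u))" if e: "0 < e" for e
  proof -
    obtain k where k: "0 < k"
      and gr: "\<And>x. e \<le> norm (x - x0) \<Longrightarrow> ereal (a + inner u (x - x0) + k * norm (x - x0)) \<le> f x"
      using subdiff_linear_growth[OF f u a e] by blast
    have "fenchel_conj f w \<le> ereal (inner w x0 - a + e * norm (w - u))" if w: "norm (w - u) < k" for w
      unfolding fenchel_conj_def
    proof (rule SUP_least)
      fix x
      have cs: "inner (w - u) (x - x0) \<le> norm (w - u) * norm (x - x0)"
        by (rule norm_cauchy_schwarz)
      show "ereal (inner w x) - f x \<le> ereal (inner w x0 - a + e * norm (w - u))"
      proof (cases "f x")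
        case (real b)
        show ?thesis
        proof (cases "e \<le> norm (x - x0)")
          case True
          have "inner (w - u) (x - x0) \<le> k * norm (x - x0)"
            using cs w by (meson less_imp_le mult_right_mono norm_ge_zero order_trans)
          moreover have "0 \<le> e * norm (w - u)" using e by simp
          ultimately show ?thesis
            using gr[OF True] real by (simp add: inner_diff_left inner_diff_right)
        next
          case False
          then have "inner (w - u) (x - x0) \<le> e * norm (w - u)"
            using cs by (smt (verit) mult.commute mult_right_mono norm_ge_zero)
          then show ?thesis
            using sub[of x] real by (simp add: inner_diff_left inner_diff_right)
        qed
      qed (use proper in \<open>auto simp: proper_fun_def\<close>)
    qed
    then show ?thesis using k by blast
  qed
  have at_u: "fenchel_conj f u = ereal (inner u x0 - a)"
  proof (rule antisym)
    show "fenchel_conj f u \<le> ereal (inner u x0 - a)"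
      using upper[of 1] by (auto dest: spec[of _ u])
  qed (rule lower)
  show "GDERIV (\<lambda>y. real_of_ereal (fenchel_conj f y)) u :> x0"
    unfolding gderiv_def has_derivative_at_alt
  proof (intro conjI allI impI)
    show "bounded_linear (\<lambda>h. inner h x0)" by (rule bounded_linear_inner_left)
    fix e :: real assume e: "0 < e"
    then obtain k where k: "0 < k" and up: "\<And>w. norm (w - u) < k \<Longrightarrow>
        fenchel_conj f w \<le> ereal (inner w x0 - a + e * norm (w - u))"
      using upper by blast
    have "norm (real_of_ereal (fenchel_conj f w) - real_of_ereal (fenchel_conj f u) - inner (w - u) x0)
        \<le> e * norm (w - u)" if "norm (w - u) < k" for w
      using up[OF that] lower[of w] at_u
      by (cases "fenchel_conj f w") (auto simp: inner_diff_left)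
    then show "\<exists>d>0. \<forall>y. norm (y - u) < d \<longrightarrow>
        norm (real_of_ereal (fenchel_conj f y) - real_of_ereal (fenchel_conj f u) - inner (y - u) x0)
        \<le> e * norm (y - u)"
      using k by blast
  qed
qed

section \<open>The gradient on the interior of the domain\<close>

lemma GDERIV_grad:
  fixes f :: "'a::euclidean_space \<Rightarrow> ereal"
  assumes f: "legendre_type f" and x: "x \<in> interior (edom f)"
  shows "GDERIV (\<lambda>y. real_of_ereal (f y)) x :> grad f x"
proof -
  obtain D where D: "((\<lambda>y. real_of_ereal (f y)) has_derivative D) (at x)"
    using f x by (auto simp: legendre_type_def essentially_smooth_def differentiable_def)
  then have "linear D" by (rule has_derivative_linear)
  then have "D = (\<lambda>h. inner h (adjoint D 1))"
    by (simp add: adjoint_works)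
  with D have "GDERIV (\<lambda>y. real_of_ereal (f y)) x :> adjoint D 1"
    unfolding gderiv_def by metis
  then show ?thesis using grad_eqI by metis
qed

lemma interior_edom_ereal:
  assumes "x \<in> interior (edom f)"
  shows "f x = ereal (real_of_ereal (f x))"
  using assms interior_subset[of "edom f"] by (auto simp: edom_def ereal_real')

text \<open>The difference quotients of \<open>f\<close> along the segment from \<open>x\<close> to \<open>y\<close> are bounded by
  \<open>f y - f x\<close> and tend to \<open>\<langle>\<nabla>f x, y - x\<rangle>\<close>.\<close>

lemma grad_in_subdiff:
  fixes f :: "'a::euclidean_space \<Rightarrow> ereal"
  assumes f: "legendre_type f" and x: "x \<in> interior (edom f)"
  shows "grad f x \<in> subdiff f x"
proof -
  have proper: "proper_fun f" and conv: "convex_fun f"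
    using f by (auto simp: legendre_type_def)
  define a where "a = real_of_ereal (f x)"
  have a: "f x = ereal a" using interior_edom_ereal[OF x] by (simp add: a_def)
  have "f x + ereal (inner (grad f x) (y - x)) \<le> f y" for y
  proof (cases "f y")
    case (real b)
    define G where "G = (\<lambda>t. real_of_ereal (f (x + t *\<^sub>R (y - x))))"
    have "((\<lambda>y. real_of_ereal (f y)) has_derivative (\<lambda>h. inner h (grad f x))) (at (x + 0 *\<^sub>R (y - x)))"
      using GDERIV_grad[OF f x] by (simp add: gderiv_def)
    moreover have "((\<lambda>t. x + t *\<^sub>R (y - x)) has_derivative (\<lambda>t. t *\<^sub>R (y - x))) (at 0)"
      by (auto intro!: derivative_eq_intros)
    ultimately have "(G has_derivative (\<lambda>t. inner (t *\<^sub>R (y - x)) (grad f x))) (at 0)"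
      unfolding G_def by (rule has_derivative_compose[rotated])
    moreover have "(\<lambda>t. inner (t *\<^sub>R (y - x)) (grad f x)) = (*) (inner (grad f x) (y - x))"
      by (rule ext) (simp add: inner_commute[of "grad f x"] mult.commute)
    ultimately have "(G has_real_derivative inner (grad f x) (y - x)) (at 0)"
      by (simp add: has_field_derivative_def)
    then have "((\<lambda>t. (G t - G 0) / t) \<longlongrightarrow> inner (grad f x) (y - x)) (at 0)"
      by (simp add: has_field_derivative_iff)
    then have lim: "((\<lambda>t. (G t - G 0) / t) \<longlongrightarrow> inner (grad f x) (y - x)) (at_right 0)"
      by (rule filterlim_mono) (auto simp: at_within_le_at)
    have "(G t - G 0) / t \<le> b - a" if t: "0 < t" "t < 1" for t
    proof -
      have "x + t *\<^sub>R (y - x) = (1 - t) *\<^sub>R x + t *\<^sub>R y" by (simp add: algebra_simps)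
      then have "f (x + t *\<^sub>R (y - x)) \<le> ereal ((1 - t) * a + t * b)"
        using convex_funD[OF conv t, of x y] a real by simp
      moreover have "f (x + t *\<^sub>R (y - x)) \<noteq> -\<infinity>"
        using proper by (simp add: proper_fun_def)
      ultimately have "G t \<le> (1 - t) * a + t * b"
        unfolding G_def by (cases "f (x + t *\<^sub>R (y - x))") auto
      moreover have "G 0 = a" by (simp add: G_def a)
      ultimately show ?thesis using t by (simp add: field_simps)
    qed
    then have "eventually (\<lambda>t. (G t - G 0) / t \<le> b - a) (at_right 0)"
      unfolding eventually_at_right_field by (intro exI[of _ 1]) auto
    then have "inner (grad f x) (y - x) \<le> b - a"
      using lim by (intro tendsto_upperbound) auto
    then show ?thesis using a real by simp
  qed (use proper in \<open>auto simp: proper_fun_def\<close>)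
  then show ?thesis by (simp add: subdiff_def)
qed

text \<open>A single first-order expansion at \<open>x\<close>, valid within \<open>2 * r\<close>, controls nearby gradients:
  the subgradient inequality at \<open>y = x + d\<close> in a direction \<open>w\<close> with \<open>norm w = r\<close> gives
  \<open>\<langle>\<nabla>f y - \<nabla>f x, w\<rangle> \<le> e * (norm (d + w) + norm d)\<close>, which is at most \<open>3 * e * r\<close> for
  \<open>norm d \<le> r\<close>.\<close>

lemma continuous_on_grad:
  fixes f :: "'a::euclidean_space \<Rightarrow> ereal"
  assumes f: "legendre_type f"
  shows "continuous_on (interior (edom f)) (grad f)"
  unfolding continuous_on_iff
proof (intro ballI allI impI)
  fix x :: 'a and e' :: real
  assume x: "x \<in> interior (edom f)" and e': "0 < e'"
  define F where "F = (\<lambda>y. real_of_ereal (f y))"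
  define e where "e = e' / 4"
  have e: "0 < e" using e' by (simp add: e_def)
  obtain d where d: "0 < d" and exp: "\<And>y. norm (y - x) < d \<Longrightarrow>
      norm (F y - F x - inner (y - x) (grad f x)) \<le> e * norm (y - x)"
    using GDERIV_grad[OF f x] e unfolding gderiv_def has_derivative_at_alt F_def by blast
  obtain s where s: "0 < s" "ball x s \<subseteq> interior (edom f)"
    using x open_interior open_contains_ball by blast
  define r where "r = min d s / 3"
  have r: "0 < r" "2 * r < d" "2 * r < s" using d s by (auto simp: r_def)
  have "dist (grad f y) (grad f x) < e'" if y: "y \<in> interior (edom f)" "dist y x < r" for y
  proof (cases "grad f y = grad f x")
    case False
    define v where "v = grad f y - grad f x"
    define w where "w = (r / norm v) *\<^sub>R v"
    have v: "0 < norm v" using False by (simp add: v_def)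
    have nw: "norm w = r" using v r by (simp add: w_def)
    have ny: "norm (y - x) < r" using y by (simp add: dist_norm)
    have nyw: "norm (y + w - x) < 2 * r"
      using norm_triangle_ineq[of "y - x" w] nw ny by (simp add: algebra_simps)
    have "y + w \<in> interior (edom f)"
      using s nyw r by (auto simp: dist_norm norm_minus_commute)
    from interior_edom_ereal[OF this] interior_edom_ereal[OF y(1)]
    have "F y + inner (grad f y) w \<le> F (y + w)"
      using subdiffD[OF grad_in_subdiff[OF f y(1)], of "y + w"] unfolding F_def
      by (cases "f y"; cases "f (y + w)") auto
    moreover have "norm (F y - F x - inner (y - x) (grad f x)) \<le> e * norm (y - x)"
      using exp ny r by auto
    moreover have "norm (F (y + w) - F x - inner (y + w - x) (grad f x)) \<le> e * norm (y + w - x)"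
      using exp nyw r by auto
    moreover have "e * norm (y - x) \<le> e * r" "e * norm (y + w - x) \<le> e * (2 * r)"
      using ny nyw e by auto
    moreover have "inner (y + w - x) (grad f x) = inner (y - x) (grad f x) + inner (grad f x) w"
      by (simp add: inner_diff_left inner_add_left inner_commute[of w])
    moreover have "inner v w = inner (grad f y) w - inner (grad f x) w"
      by (simp add: v_def inner_diff_left)
    ultimately have "inner v w \<le> e * r + e * (2 * r)"
      unfolding real_norm_def by linarith
    moreover have "inner v w = r * norm v"
      using v by (simp add: w_def dot_square_norm power2_eq_square)
    ultimately have "r * norm v \<le> r * (3 * e)" by (simp add: algebra_simps)
    then have "norm v \<le> 3 * e" using r by simp
    then show ?thesis using e' by (simp add: v_def dist_norm e_def)
  qed (use e' in auto)
  then show "\<exists>d>0. \<forall>y\<in>interior (edom f). dist y x < d \<longrightarrow> dist (grad f y) (grad f x) < e'"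
    using r by blast
qed

lemma continuous_on_interior_edom:
  fixes f :: "'a::euclidean_space \<Rightarrow> ereal"
  assumes f: "legendre_type f"
  shows "continuous_on (interior (edom f)) (\<lambda>y. real_of_ereal (f y))"
proof (rule continuous_at_imp_continuous_on, rule ballI)
  fix x assume "x \<in> interior (edom f)"
  then have "(\<lambda>y. real_of_ereal (f y)) differentiable (at x)"
    using f by (simp add: legendre_type_def essentially_smooth_def)
  then show "isCont (\<lambda>y. real_of_ereal (f y)) x"
    by (rule differentiable_imp_continuous_within)
qed

section \<open>Slopes with a coercive tilt\<close>

text \<open>The slopes \<open>u\<close> for which \<open>f - \<langle>u, \<cdot>\<rangle>\<close> grows at least linearly. For proper \<open>f\<close>
  this is the interior of the domain of the conjugate: the inequality for \<open>k\<close> and \<open>b\<close> says that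
  the conjugate is at most \<open>b\<close> on the ball of radius \<open>k\<close> around \<open>u\<close>.\<close>

definition coercive_slopes :: "('a::real_inner \<Rightarrow> ereal) \<Rightarrow> 'a set" where
  "coercive_slopes f = {u. \<exists>k>0. \<exists>b. \<forall>x. ereal (inner u x + k * norm x - b) \<le> f x}"

lemma convex_coercive_slopes: "convex (coercive_slopes f)"
  unfolding convex_def
proof (intro ballI allI impI)
  fix u v and s t :: real
  assume u: "u \<in> coercive_slopes f" and v: "v \<in> coercive_slopes f"
    and s: "0 \<le> s" and t: "0 \<le> t" and st: "s + t = 1"
  obtain k b where k: "0 < k" "\<And>x. ereal (inner u x + k * norm x - b) \<le> f x"
    using u by (auto simp: coercive_slopes_def)
  obtain l c where l: "0 < l" "\<And>x. ereal (inner v x + l * norm x - c) \<le> f x"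
    using v by (auto simp: coercive_slopes_def)
  have "0 < s * k + t * l"
  proof (cases "s = 0")
    case False
    then show ?thesis using s t k(1) l(1) by (intro add_pos_nonneg) auto
  qed (use st l(1) in auto)
  moreover have "ereal (inner (s *\<^sub>R u + t *\<^sub>R v) x + (s * k + t * l) * norm x - (s * b + t * c)) \<le> f x" for x
  proof (cases "f x")
    case (real q)
    have "s * (inner u x + k * norm x - b) + t * (inner v x + l * norm x - c) \<le> q"
      using k(2)[of x] l(2)[of x] real s t st by (intro convex_bound_le) auto
    then show ?thesis using real by (simp add: inner_add_left algebra_simps)
  qed (use k(2)[of x] in auto)
  ultimately show "s *\<^sub>R u + t *\<^sub>R v \<in> coercive_slopes f"
    unfolding coercive_slopes_def by blast
qed

lemma subdiff_coercive_slopes: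
  fixes f :: "'a::euclidean_space \<Rightarrow> ereal"
  assumes f: "legendre_type f" and u: "u \<in> subdiff f x0"
  shows "u \<in> coercive_slopes f"
proof -
  have proper: "proper_fun f" using f by (simp add: legendre_type_def)
  obtain a where a: "f x0 = ereal a"
    using subdiff_imp_finite[OF proper u] by blast
  obtain k where k: "0 < k"
    and gr: "\<And>x. 1 \<le> norm (x - x0) \<Longrightarrow> ereal (a + inner u (x - x0) + k * norm (x - x0)) \<le> f x"
    using subdiff_linear_growth[OF f u a, of 1] by auto
  have "ereal (inner u x + k * norm x - (inner u x0 - a + k + k * norm x0)) \<le> f x" for x
  proof -
    have tri: "k * norm x \<le> k * norm (x - x0) + k * norm x0"
      using k norm_triangle_sub[of x x0] by (simp flip: distrib_left)
    show ?thesis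
    proof (cases "1 \<le> norm (x - x0)")
      case True
      have "inner u x + k * norm x - (inner u x0 - a + k + k * norm x0)
          \<le> a + inner u (x - x0) + k * norm (x - x0)"
        using tri k by (simp add: inner_diff_right)
      then show ?thesis using gr[OF True] by (meson ereal_less_eq(3) order_trans)
    next
      case False
      then have "k * norm (x - x0) \<le> k" using k by (simp add: mult_le_cancel_left1)
      then have "inner u x + k * norm x - (inner u x0 - a + k + k * norm x0) \<le> a + inner u (x - x0)"
        using tri by (simp add: inner_diff_right)
      moreover have "ereal (a + inner u (x - x0)) \<le> f x"
        using subdiffD[OF u, of x] a by simp
      ultimately show ?thesis by (meson ereal_less_eq(3) order_trans)
    qed
  qed
  then show ?thesis using k unfolding coercive_slopes_def by blast
qed

text \<open>\<open>f - \<langle>u, \<cdot>\<rangle>\<close> attains its minimum, and \<open>u\<close> is a subgradient of \<open>f\<close> at every minimizer.\<close>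

lemma coercive_slope_in_subdiff:
  fixes f :: "'a::euclidean_space \<Rightarrow> ereal"
  assumes lsc: "lsc_fun f" and proper: "proper_fun f" and u: "u \<in> coercive_slopes f"
  shows "\<exists>x. u \<in> subdiff f x"
proof -
  define g where "g = (\<lambda>x. f x + ereal (inner (- u) x))"
  obtain k b where k: "0 < k" "\<And>x. ereal (inner u x + k * norm x - b) \<le> f x"
    using u by (auto simp: coercive_slopes_def)
  obtain x0 where x0: "f x0 \<noteq> \<infinity>" using proper by (auto simp: proper_fun_def)
  have "\<exists>x. is_minimizer g x"
  proof (rule coercive_attains_min)
    show "closed {x. g x \<le> a}" for a
      unfolding g_def by (intro closed_sublevel_add_continuous lsc continuous_intros)
    show "g x0 \<noteq> \<infinity>" using x0 by (simp add: g_def)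
    show "ereal (k * norm x - b) \<le> g x" for x
      using k(2)[of x] by (cases "f x") (auto simp: g_def)
  qed (fact k(1))
  then obtain x where x: "\<And>y. g x \<le> g y" by (auto simp: is_minimizer_def)
  have "f x + ereal (inner u (y - x)) \<le> f y" for y
    using x[of y] x[of x0] x0 proper
    by (cases "f x"; cases "f y") (auto simp: g_def proper_fun_def inner_diff_right algebra_simps)
  then show ?thesis by (auto simp: subdiff_def)
qed

section \<open>First-order condition for a convex function plus a maximum of affine functions\<close>

text \<open>This is a form of Danskin's theorem. Here \<open>x\<close> minimizes
  \<open>z \<mapsto> f z + (MAX c\<in>C. \<psi> c - \<langle>p c, z\<rangle>)\<close> with minimal value \<open>M\<close>. The pieces active at the points
  \<open>x + t (y - x)\<close> accumulate, as \<open>t\<close> tends to \<open>0\<close>, at a piece \<open>c\<close> which is active at \<open>x\<close> and along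
  which \<open>f\<close> cannot decrease towards \<open>y\<close>.\<close>

lemma active_piece_in_direction:
  fixes f :: "'a::euclidean_space \<Rightarrow> ereal" and C :: "'b::metric_space set"
  assumes conv: "convex_fun f" and proper: "proper_fun f"
    and C: "compact C" and p: "continuous_on C p" and \<psi>: "continuous_on C \<psi>"
    and a: "f x = ereal a" and b: "f y = ereal b"
    and low: "\<And>z. \<exists>c\<in>C. ereal M \<le> f z + ereal (\<psi> c - inner (p c) z)"
    and up: "\<And>c. c \<in> C \<Longrightarrow> a + \<psi> c - inner (p c) x \<le> M"
  shows "\<exists>c\<in>C. a + \<psi> c - inner (p c) x = M \<and> inner (p c) (y - x) \<le> b - a"
proof -
  define t :: "nat \<Rightarrow> real" where "t = (\<lambda>n. 1 / (real n + 2))"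
  have t: "0 < t n" "t n < 1" for n by (auto simp: t_def)
  have t0: "t \<longlonglongrightarrow> 0"
    using LIMSEQ_ignore_initial_segment[OF lim_1_over_n[where 'a = real], of 2]
    by (simp add: t_def add.commute)
  have "\<forall>n. \<exists>c\<in>C. ereal M \<le> f ((1 - t n) *\<^sub>R x + t n *\<^sub>R y)
      + ereal (\<psi> c - inner (p c) ((1 - t n) *\<^sub>R x + t n *\<^sub>R y))"
    using low by blast
  then obtain c where c: "\<And>n. c n \<in> C" and Mc: "\<And>n. ereal M \<le> f ((1 - t n) *\<^sub>R x + t n *\<^sub>R y)
      + ereal (\<psi> (c n) - inner (p (c n)) ((1 - t n) *\<^sub>R x + t n *\<^sub>R y))"
    by metis
  have M1: "M \<le> a + \<psi> (c n) - inner (p (c n)) x + t n * (b - a - inner (p (c n)) (y - x))" for n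
  proof -
    have "f ((1 - t n) *\<^sub>R x + t n *\<^sub>R y) \<le> ereal ((1 - t n) * a + t n * b)"
      using convex_funD[OF conv t, of n x y] a b by simp
    then have "M \<le> (1 - t n) * a + t n * b
        + (\<psi> (c n) - inner (p (c n)) ((1 - t n) *\<^sub>R x + t n *\<^sub>R y))"
      using Mc[of n] proper
      by (cases "f ((1 - t n) *\<^sub>R x + t n *\<^sub>R y)") (auto simp: proper_fun_def)
    then show ?thesis by (simp add: inner_diff_right inner_add_right algebra_simps)
  qed
  have slope: "inner (p (c n)) (y - x) \<le> b - a" for n
  proof -
    have "0 \<le> t n * (b - a - inner (p (c n)) (y - x))"
      using M1[of n] up[OF c[of n]] by simp
    then show ?thesis using t[of n] by (simp add: zero_le_mult_iff)
  qed
  obtain c0 r where c0: "c0 \<in> C" and r: "strict_mono r" and lim: "(c \<circ> r) \<longlonglongrightarrow> c0"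
    using C c unfolding compact_def by blast
  have lp: "(\<lambda>n. p (c (r n))) \<longlonglongrightarrow> p c0" and l\<psi>: "(\<lambda>n. \<psi> (c (r n))) \<longlonglongrightarrow> \<psi> c0"
    using continuous_on_tendsto_compose[OF p lim c0] continuous_on_tendsto_compose[OF \<psi> lim c0] c
    by auto
  have lt: "(\<lambda>n. t (r n)) \<longlonglongrightarrow> 0"
    using LIMSEQ_subseq_LIMSEQ[OF t0 r] by (simp add: o_def)
  have "(\<lambda>n. a + \<psi> (c (r n)) - inner (p (c (r n))) x
      + t (r n) * (b - a - inner (p (c (r n))) (y - x)))
      \<longlonglongrightarrow> a + \<psi> c0 - inner (p c0) x + 0 * (b - a - inner (p c0) (y - x))"
    by (intro tendsto_intros lp l\<psi> lt)
  then have "M \<le> a + \<psi> c0 - inner (p c0) x + 0 * (b - a - inner (p c0) (y - x))"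
    by (rule LIMSEQ_le_const) (use M1 in auto)
  moreover have "inner (p c0) (y - x) \<le> b - a"
    by (rule LIMSEQ_le_const2[OF tendsto_inner[OF lp tendsto_const]]) (use slope in auto)
  ultimately show ?thesis using up[OF c0] c0 by auto
qed

text \<open>If in every direction some slope of the convex compact set \<open>K\<close> lies below \<open>f\<close>, a single one
  works for all directions. A hyperplane separates the epigraph of \<open>f\<close>, translated so that \<open>(x, f x)\<close>
  is the origin, from the strict hypograph of the concave function \<open>d \<mapsto> (MIN u\<in>K. \<langle>u, d\<rangle>)\<close>. The
  hyperplane is the graph of a linear function \<open>\<langle>w, \<cdot>\<rangle>\<close>: lying below \<open>f\<close> makes \<open>w\<close> a subgradient, and
  lying above the minimum puts \<open>w\<close> into \<open>K\<close>.\<close>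

lemma uniform_subgradient:
  fixes f :: "'a::euclidean_space \<Rightarrow> ereal"
  assumes conv: "convex_fun f" and proper: "proper_fun f"
    and K: "compact K" "convex K" "K \<noteq> {}" and a: "f x = ereal a"
    and ex: "\<And>y b. f y = ereal b \<Longrightarrow> \<exists>u\<in>K. inner u (y - x) \<le> b - a"
  shows "\<exists>u\<in>K. u \<in> subdiff f x"
proof -
  define A where "A = {(d, r). f (x + d) \<le> ereal (a + r)}"
  define B where "B = {(d, r). \<forall>u\<in>K. r < inner u d}"
  have below_B: "\<exists>r0. \<forall>r<r0. (d, r) \<in> B" for d
  proof -
    have "compact ((\<lambda>u. inner u d) ` K)"
      by (intro compact_continuous_image continuous_intros K)
    then have "bdd_below ((\<lambda>u. inner u d) ` K)"
      by (intro bounded_imp_bdd_below compact_imp_bounded)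
    then obtain r0 where r0: "\<forall>u\<in>K. r0 \<le> inner u d"
      by (auto simp: bdd_below_def)
    then show ?thesis unfolding B_def by (intro exI[of _ r0]) (auto intro: less_le_trans)
  qed
  have "convex A"
    unfolding convex_alt
  proof (intro ballI allI impI)
    fix P Q and t :: real assume PQ: "P \<in> A" "Q \<in> A" and t01: "0 \<le> t \<and> t \<le> 1"
    obtain d r d' r' where P: "P = (d, r)" and Q: "Q = (d', r')" by fastforce
    show "(1 - t) *\<^sub>R P + t *\<^sub>R Q \<in> A"
    proof (cases "t = 0 \<or> t = 1")
      case False
      with t01 have t: "0 < t" "t < 1" by auto
      have "f ((1 - t) *\<^sub>R (x + d) + t *\<^sub>R (x + d')) \<le> ereal (1 - t) * f (x + d) + ereal t * f (x + d')"
        using convex_funD[OF conv t] .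
      also have "\<dots> \<le> ereal (1 - t) * ereal (a + r) + ereal t * ereal (a + r')"
        using PQ t by (intro add_mono ereal_mult_left_mono) (auto simp: A_def P Q)
      also have "\<dots> = ereal (a + ((1 - t) * r + t * r'))"
        by (simp add: algebra_simps)
      also have "(1 - t) *\<^sub>R (x + d) + t *\<^sub>R (x + d') = x + ((1 - t) *\<^sub>R d + t *\<^sub>R d')"
        by (simp add: algebra_simps)
      finally show ?thesis by (simp add: A_def P Q)
    qed (use PQ in auto)
  qed
  moreover have "convex B"
    unfolding convex_alt
  proof (intro ballI allI impI)
    fix P Q and t :: real assume PQ: "P \<in> B" "Q \<in> B" and t: "0 \<le> t \<and> t \<le> 1"
    obtain d r d' r' where P: "P = (d, r)" and Q: "Q = (d', r')" by fastforce
    have "(1 - t) * r + t * r' < inner u ((1 - t) *\<^sub>R d + t *\<^sub>R d')" if u: "u \<in> K" for u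
    proof -
      have 1: "r < inner u d" "r' < inner u d'" using PQ u by (auto simp: B_def P Q)
      have "(1 - t) * r + t * r' < (1 - t) * inner u d + t * inner u d'"
      proof (cases "t = 0")
        case False
        then show ?thesis using 1 t by (intro add_le_less_mono mult_left_mono mult_strict_left_mono) auto
      qed (use 1 in auto)
      then show ?thesis by (simp add: inner_add_right)
    qed
    then show "(1 - t) *\<^sub>R P + t *\<^sub>R Q \<in> B" by (auto simp: B_def P Q)
  qed
  moreover have A0: "(0, 0) \<in> A" by (simp add: A_def a)
  moreover obtain r0 where "\<forall>r<r0. (0::'a, r) \<in> B" using below_B by blast
  then have "(0, r0 - 1) \<in> B" by simp
  moreover have "B \<inter> A = {}"
  proof (safe)
    fix d r assume B: "(d, r) \<in> B" and A: "(d, r) \<in> A"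
    obtain b where b: "f (x + d) = ereal b" "b \<le> a + r"
      using A proper by (cases "f (x + d)") (auto simp: A_def proper_fun_def)
    obtain u where "u \<in> K" "inner u d \<le> b - a" using ex[OF b(1)] by auto
    then show "(d, r) \<in> {}" using B b(2) by (force simp: B_def)
  qed
  ultimately obtain z \<beta> where z: "z \<noteq> 0" and zB: "\<forall>P\<in>B. inner z P \<le> \<beta>" and zA: "\<forall>P\<in>A. \<beta> \<le> inner z P"
    using separating_hyperplane_sets[of B A] by blast
  obtain p \<alpha> where p: "z = (p, \<alpha>)" by fastforce
  have B1: "inner p d + \<alpha> * r \<le> \<beta>" if "(d, r) \<in> B" for d r
    using zB that by (auto simp: p)
  have A1: "\<beta> \<le> inner p d + \<alpha> * r" if "(d, r) \<in> A" for d r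
    using zA that by (auto simp: p)
  \<comment> \<open>The hypograph is unbounded below, so the hyperplane is tilted the right way.\<close>
  have "0 \<le> \<alpha>"
  proof (rule ccontr)
    assume neg: "\<not> 0 \<le> \<alpha>"
    obtain r0 where r0: "\<forall>r<r0. (0::'a, r) \<in> B" using below_B by blast
    define r where "r = min (r0 - 1) ((\<beta> + 1) / \<alpha>)"
    have "\<alpha> * ((\<beta> + 1) / \<alpha>) \<le> \<alpha> * r"
      using neg by (intro mult_left_mono_neg) (auto simp: r_def)
    moreover have "\<alpha> * r \<le> \<beta>" using B1[of 0 r] r0 by (auto simp: r_def)
    ultimately show False using neg by simp
  qed
  \<comment> \<open>The hypograph lies over the whole space, so the hyperplane is not vertical.\<close>
  moreover have "\<alpha> \<noteq> 0"
  proof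
    assume 0: "\<alpha> = 0"
    have le: "inner p d \<le> \<beta>" for d
    proof -
      obtain r0 where "\<forall>r<r0. (d, r) \<in> B" using below_B by blast
      then have "(d, r0 - 1) \<in> B" by simp
      then show ?thesis using B1 0 by fastforce
    qed
    have "p \<noteq> 0" using z 0 p by (simp add: zero_prod_def)
    then have "inner p (((\<beta> + 1) / inner p p) *\<^sub>R p) = \<beta> + 1" by simp
    then show False using le by (metis add_le_same_cancel1 not_one_le_zero)
  qed
  ultimately have \<alpha>: "0 < \<alpha>" by simp
  have \<beta>0: "\<beta> \<le> 0" using A1[OF A0] by simp
  define w where "w = - (p /\<^sub>R \<alpha>)"
  have wd: "inner w d = - inner p d / \<alpha>" for d by (simp add: w_def divide_inverse_commute)
  have above: "r \<le> inner w d" if r: "\<forall>u\<in>K. r \<le> inner u d" for d r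
  proof -
    have "\<alpha> * s \<le> \<beta> - inner p d" if "s < r" for s
    proof -
      have "(d, s) \<in> B" using r that by (force simp: B_def)
      then show ?thesis using B1 by fastforce
    qed
    then have "s \<le> inner w d" if "s < r" for s
    proof -
      have "\<alpha> * s \<le> - inner p d" using \<open>\<And>s. s < r \<Longrightarrow> \<alpha> * s \<le> \<beta> - inner p d\<close>[OF that] \<beta>0 by simp
      then show ?thesis using \<alpha> by (simp add: wd field_simps)
    qed
    then show ?thesis by (rule dense_le)
  qed
  have \<beta>1: "0 \<le> \<beta>"
  proof -
    have "r \<le> \<beta> / \<alpha>" if "r < 0" for r
    proof -
      have "(0, r) \<in> B" using that by (simp add: B_def)
      then show ?thesis using B1 \<alpha> by (fastforce simp: field_simps)
    qed
    then have "0 \<le> \<beta> / \<alpha>" by (rule dense_le)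
    then show ?thesis using \<alpha> by (simp add: zero_le_divide_iff)
  qed
  have "w \<in> K"
  proof (rule ccontr)
    assume "w \<notin> K"
    then obtain q s where q: "inner q w < s" "\<forall>u\<in>K. s < inner q u"
      using separating_hyperplane_closed_point[of K w] K compact_imp_closed by blast
    then have "s \<le> inner w q" by (intro above) (auto simp: inner_commute less_imp_le)
    then show False using q by (simp add: inner_commute)
  qed
  moreover have "f x + ereal (inner w (y - x)) \<le> f y" for y
  proof (cases "f y")
    case (real b)
    then have "(y - x, b - a) \<in> A" by (simp add: A_def)
    then have "0 \<le> inner p (y - x) + \<alpha> * (b - a)" using A1 \<beta>1 by fastforce
    then have "inner w (y - x) \<le> b - a" using \<alpha> by (simp add: wd field_simps)
    then show ?thesis using a real by simp
  qed (use proper in \<open>auto simp: proper_fun_def\<close>)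
  ultimately show ?thesis by (auto simp: subdiff_def)
qed

section \<open>The Chebyshev center\<close>

lemma bregman_eq_affine:
  assumes c: "c \<in> interior (edom f)"
  shows "bregman f x c = f x + ereal (inner (grad f c) c - real_of_ereal (f c) - inner (grad f c) x)"
proof -
  obtain q where q: "f c = ereal q" using interior_edom_ereal[OF c] by blast
  show ?thesis using c by (cases "f x") (auto simp: bregman_def q inner_diff_right)
qed

lemma bregman_nonneg:
  fixes f :: "'a::euclidean_space \<Rightarrow> ereal"
  assumes f: "legendre_type f" and c: "c \<in> interior (edom f)"
  shows "0 \<le> bregman f x c"
proof -
  have "f c + ereal (inner (grad f c) (x - c)) \<le> f x"
    using grad_in_subdiff[OF f c] by (rule subdiffD)
  then show ?thesis
    using interior_edom_ereal[OF c] unfolding bregman_eq_affine[OF c]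
    by (cases "f x"; cases "f c") (auto simp: inner_diff_right inner_diff_left)
qed

text \<open>For fixed \<open>x\<close> the distance \<open>D (x, c)\<close> is continuous in \<open>c \<in> C\<close>, so the farthest points form
  the nonempty compact set where it attains its maximum.\<close>

lemma right_farthest_points_compact_nonempty:
  fixes f :: "'a::euclidean_space \<Rightarrow> ereal"
  assumes f: "legendre_type f" and C: "C \<noteq> {}" "compact C" "C \<subseteq> interior (edom f)"
    and x: "x \<in> edom f"
  shows "compact (grad f ` right_farthest_points f C x)" "right_farthest_points f C x \<noteq> {}"
    and "right_farthest_dist f C x \<noteq> \<infinity>"
proof -
  define l where "l c = inner (grad f c) c - real_of_ereal (f c) - inner (grad f c) x" for c
  obtain a where a: "f x = ereal a" using x by (auto simp: edom_def)
  have contg: "continuous_on C (grad f)" and contf: "continuous_on C (\<lambda>y. real_of_ereal (f y))"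
    using continuous_on_grad[OF f] continuous_on_interior_edom[OF f] C(3) continuous_on_subset by blast+
  then have contl: "continuous_on C l"
    unfolding l_def by (intro continuous_intros)
  have D: "bregman f x c = ereal (a + l c)" if "c \<in> C" for c
    using bregman_eq_affine[of c f x] that C(3) by (auto simp: l_def a)
  obtain c where c: "c \<in> C" "\<forall>c'\<in>C. l c' \<le> l c"
    using continuous_attains_sup[OF C(2,1) contl] by blast
  have F: "right_farthest_dist f C x = ereal (a + l c)"
    unfolding right_farthest_dist_def
    using c by (intro antisym SUP_least SUP_upper2[of c]) (auto simp: D)
  then show "right_farthest_dist f C x \<noteq> \<infinity>" by simp
  have Q: "right_farthest_points f C x = {c' \<in> C. l c' = l c}"
    using x by (auto simp: right_farthest_points_def F D)
  then show "right_farthest_points f C x \<noteq> {}" using c by auto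
  have "closed {c' \<in> C. l c' = l c}"
    using continuous_closed_preimage_constant[OF contl] C(2) compact_imp_closed by blast
  then have "compact (right_farthest_points f C x)"
    unfolding Q using C(2) by (metis (no_types, lifting) compact_Int_closed inf.absorb2 mem_Collect_eq subsetI)
  then show "compact (grad f ` right_farthest_points f C x)"
    using contg Q by (intro compact_continuous_image) (auto intro: continuous_on_subset)
qed

text \<open>For each farthest point \<open>c\<close> of \<open>x\<close>, \<open>D (y, c) - D (x, c) = f y - f x - \<langle>\<nabla>f c, y - x\<rangle>\<close> bounds
  the change of the farthest distance from below. The bound depends affinely on \<open>\<nabla>f c\<close>, so it
  extends to the convex hull.\<close>

lemma right_farthest_dist_growth:
  fixes f :: "'a::euclidean_space \<Rightarrow> ereal"
  assumes C: "C \<subseteq> interior (edom f)" and x: "f x = ereal a"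
    and u: "u \<in> convex hull (grad f ` right_farthest_points f C x)"
    and y: "f y = ereal b"
  shows "right_farthest_dist f C x + ereal (b - a - inner u (y - x)) \<le> right_farthest_dist f C y"
proof -
  let ?F = "right_farthest_dist f C"
  define H where "H = {u. ?F x + ereal (b - a - inner u (y - x)) \<le> ?F y}"
  have "convex H"
  proof (cases "?F x"; cases "?F y")
    fix r s assume r: "?F x = ereal r" and s: "?F y = ereal s"
    have "H = {u. inner (y - x) u \<ge> r + b - a - s}"
      by (auto simp: H_def r s inner_commute)
    then show ?thesis by (simp add: convex_halfspace_ge)
  qed (auto simp: H_def convex_empty)
  moreover have "grad f ` right_farthest_points f C x \<subseteq> H"
  proof safe
    fix c assume "c \<in> right_farthest_points f C x"
    then have c: "c \<in> C" and D: "bregman f x c = ?F x"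
      by (auto simp: right_farthest_points_def split: if_splits)
    have cU: "c \<in> interior (edom f)" using c C by auto
    have "?F x + ereal (b - a - inner (grad f c) (y - x)) = bregman f y c"
      unfolding D[symmetric] bregman_eq_affine[OF cU] by (simp add: x y inner_diff_right)
    also have "\<dots> \<le> ?F y" unfolding right_farthest_dist_def using c by (rule SUP_upper)
    finally show "grad f c \<in> H" by (simp add: H_def)
  qed
  ultimately have "convex hull (grad f ` right_farthest_points f C x) \<subseteq> H"
    by (rule hull_minimal[rotated])
  then show ?thesis using u by (auto simp: H_def)
qed

lemma right_farthest_dist_outside_edom:
  assumes "proper_fun f" and C: "C \<noteq> {}" "C \<subseteq> interior (edom f)" and y: "y \<notin> edom f"
  shows "right_farthest_dist f C y = \<infinity>"
proof -
  obtain c where c: "c \<in> C" using C by auto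
  have "f y = \<infinity>" using y assms(1) by (auto simp: edom_def proper_fun_def)
  then have "bregman f y c = \<infinity>" using bregman_eq_affine[of c f y] c C by auto
  moreover have "bregman f y c \<le> right_farthest_dist f C y"
    unfolding right_farthest_dist_def using c by (rule SUP_upper)
  ultimately show ?thesis by simp
qed

text \<open>If \<open>u\<close> is in addition a subgradient of \<open>f\<close> at \<open>x\<close>, the growth bound is positive away from \<open>x\<close>
  because \<open>x\<close> is the only minimizer of \<open>f - \<langle>u, \<cdot>\<rangle>\<close>. This gives both the sufficiency of the
  condition and the uniqueness of the center.\<close>

lemma right_farthest_dist_strict_min:
  fixes f :: "'a::euclidean_space \<Rightarrow> ereal"
  assumes f: "legendre_type f" and C: "C \<noteq> {}" "compact C" "C \<subseteq> interior (edom f)"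
    and x: "x \<in> edom f"
    and u: "u \<in> convex hull (grad f ` right_farthest_points f C x)" "u \<in> subdiff f x"
    and ne: "y \<noteq> x"
  shows "right_farthest_dist f C x < right_farthest_dist f C y"
proof (cases "y \<in> edom f")
  case True
  have proper: "proper_fun f" using f by (simp add: legendre_type_def)
  obtain a b where a: "f x = ereal a" and b: "f y = ereal b"
    using x True by (auto simp: edom_def)
  obtain k where k: "0 < k" and "ereal (a + inner u (y - x) + k * norm (y - x)) \<le> f y"
    using subdiff_linear_growth[OF f u(2) a, of "norm (y - x)"] ne by auto
  moreover have "0 < k * norm (y - x)" using k ne by simp
  ultimately have "0 < b - a - inner u (y - x)" by (simp add: b)
  moreover obtain r where "right_farthest_dist f C x = ereal r"
  proof -
    obtain c where c: "c \<in> right_farthest_points f C x"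
      using right_farthest_points_compact_nonempty(2)[OF f C x] by blast
    then have "0 \<le> right_farthest_dist f C x"
      using bregman_nonneg[OF f, of c x] C(3) by (auto simp: right_farthest_points_def x)
    then show thesis
      using that right_farthest_points_compact_nonempty(3)[OF f C x]
      by (cases "right_farthest_dist f C x") auto
  qed
  ultimately show ?thesis
    using right_farthest_dist_growth[OF C(3) a u(1) b]
    by (cases "right_farthest_dist f C y") auto
next
  case False
  then show ?thesis
    using right_farthest_dist_outside_edom[of f C y] right_farthest_points_compact_nonempty(3)[OF f C x] f C
    by (auto simp: legendre_type_def less_top)
qed

text \<open>The farthest distance is \<open>f\<close> plus a maximum of affine functions with slopes \<open>- \<nabla>f c\<close>, whose
  active pieces at \<open>x\<close> belong to the farthest points of \<open>x\<close>. Minimality gives one suitable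
  slope per direction, and separation gives one for all directions.\<close>

lemma minimizer_imp_common_subgradient:
  fixes f :: "'a::euclidean_space \<Rightarrow> ereal"
  assumes f: "legendre_type f" and C: "C \<noteq> {}" "compact C" "C \<subseteq> interior (edom f)"
    and x: "x \<in> edom f" and min: "is_minimizer (right_farthest_dist f C) x"
  shows "\<exists>u\<in>convex hull (grad f ` right_farthest_points f C x). u \<in> subdiff f x"
proof -
  let ?F = "right_farthest_dist f C" and ?Q = "right_farthest_points f C"
  have proper: "proper_fun f" and conv: "convex_fun f"
    using f by (auto simp: legendre_type_def)
  define \<psi> where "\<psi> = (\<lambda>c. inner (grad f c) c - real_of_ereal (f c))"
  have contg: "continuous_on C (grad f)" and contf: "continuous_on C (\<lambda>y. real_of_ereal (f y))"
    using continuous_on_grad[OF f] continuous_on_interior_edom[OF f] C(3) continuous_on_subset by blast+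
  have cont\<psi>: "continuous_on C \<psi>"
    unfolding \<psi>_def by (intro continuous_intros contg contf)
  have D: "bregman f z c = f z + ereal (\<psi> c - inner (grad f c) z)" if "c \<in> C" for z c
    using bregman_eq_affine[of c f z] that C(3) by (auto simp: \<psi>_def)
  obtain a where a: "f x = ereal a" using x by (auto simp: edom_def)
  obtain c0 where c0: "c0 \<in> C" "bregman f x c0 = ?F x"
    using right_farthest_points_compact_nonempty(2)[OF f C x] x by (auto simp: right_farthest_points_def)
  define M where "M = a + \<psi> c0 - inner (grad f c0) x"
  have M: "?F x = ereal M" using D[OF c0(1), of x] unfolding c0(2) by (simp add: a M_def algebra_simps)
  have up: "a + \<psi> c - inner (grad f c) x \<le> M" if "c \<in> C" for c
  proof -
    have "bregman f x c \<le> ?F x" unfolding right_farthest_dist_def using that by (rule SUP_upper)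
    then show ?thesis using that by (simp add: D M a)
  qed
  have low: "\<exists>c\<in>C. ereal M \<le> f z + ereal (\<psi> c - inner (grad f c) z)" for z
  proof (cases "z \<in> edom f")
    case True
    then obtain c where "c \<in> C" "bregman f z c = ?F z"
      using right_farthest_points_compact_nonempty(2)[OF f C True] by (auto simp: right_farthest_points_def)
    moreover have "ereal M \<le> ?F z" using min M by (metis is_minimizer_def)
    ultimately show ?thesis using D by (intro bexI[of _ c]) auto
  next
    case False
    then have "f z = \<infinity>" using proper by (auto simp: edom_def proper_fun_def)
    then show ?thesis using c0(1) by auto
  qed
  show ?thesis
  proof (rule uniform_subgradient[OF conv proper _ convex_convex_hull _ a])
    show "compact (convex hull (grad f ` ?Q x))"
      using right_farthest_points_compact_nonempty(1)[OF f C x] by (rule compact_convex_hull)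
    show "convex hull (grad f ` ?Q x) \<noteq> {}"
      using right_farthest_points_compact_nonempty(2)[OF f C x] by simp
    fix y b assume b: "f y = ereal b"
    obtain c where c: "c \<in> C" "a + \<psi> c - inner (grad f c) x = M" "inner (grad f c) (y - x) \<le> b - a"
      using active_piece_in_direction[OF conv proper C(2) contg cont\<psi> a b low up] by blast
    have "c \<in> ?Q x" using c x by (auto simp: right_farthest_points_def D M a)
    then show "\<exists>u\<in>convex hull (grad f ` ?Q x). inner u (y - x) \<le> b - a"
      using c(3) by (meson hull_inc imageI)
  qed
qed

lemma right_farthest_dist_has_minimizer:
  fixes f :: "'a::euclidean_space \<Rightarrow> ereal"
  assumes f: "legendre_type f" and C: "C \<noteq> {}" "compact C" "C \<subseteq> interior (edom f)"
  shows "\<exists>x. is_minimizer (right_farthest_dist f C) x"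
proof -
  let ?F = "right_farthest_dist f C"
  have lsc: "lsc_fun f" using f by (auto simp: legendre_type_def)
  obtain c0 where c0: "c0 \<in> C" using C by auto
  then have c0U: "c0 \<in> interior (edom f)" using C(3) by auto
  have "grad f c0 \<in> coercive_slopes f"
    using subdiff_coercive_slopes[OF f grad_in_subdiff[OF f c0U]] .
  then obtain k b where k: "0 < k" "\<And>x. ereal (inner (grad f c0) x + k * norm x - b) \<le> f x"
    by (auto simp: coercive_slopes_def)
  define s where "s = inner (grad f c0) c0 - real_of_ereal (f c0)"
  show ?thesis
  proof (rule coercive_attains_min)
    show "closed {x. ?F x \<le> a}" for a
    proof -
      have "{x. ?F x \<le> a} = (\<Inter>c\<in>C. {x. bregman f x c \<le> a})"
        by (auto simp: right_farthest_dist_def SUP_le_iff)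
      moreover have "closed {x. bregman f x c \<le> a}" if "c \<in> C" for c
      proof -
        have cU: "c \<in> interior (edom f)" using that C(3) by auto
        show ?thesis
          unfolding bregman_eq_affine[OF cU]
          by (intro closed_sublevel_add_continuous lsc continuous_intros)
      qed
      ultimately show ?thesis by auto
    qed
    show "?F c0 \<noteq> \<infinity>"
      using right_farthest_points_compact_nonempty(3)[OF f C] c0U interior_subset by blast
    show "ereal (k * norm x - (b - s)) \<le> ?F x" for x
    proof -
      have "ereal (k * norm x - (b - s)) \<le> bregman f x c0"
        using k(2)[of x] unfolding bregman_eq_affine[OF c0U]
        by (cases "f x") (auto simp: s_def)
      also have "\<dots> \<le> ?F x" unfolding right_farthest_dist_def using c0 by (rule SUP_upper)
      finally show ?thesis .
    qed
  qed (fact k(1))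
qed

theorem theorem4p4:
  fixes f :: "real ^ 'j \<Rightarrow> ereal" and C :: "(real ^ 'j) set"
  assumes "legendre_type f"
    and "C \<noteq> {}" and "compact C" and "C \<subseteq> interior (edom f)"
  shows "(\<exists>!x. is_minimizer (right_farthest_dist f C) x) \<and>
    (\<forall>x. is_minimizer (right_farthest_dist f C) x \<longrightarrow> x \<in> edom f) \<and>
    (\<forall>x\<in>edom f. is_minimizer (right_farthest_dist f C) x \<longleftrightarrow>
       x \<in> grad (fenchel_conj f) ` (convex hull (grad f ` right_farthest_points f C x)))"
proof -
  let ?F = "right_farthest_dist f C" and ?Q = "right_farthest_points f C"
  note f = assms(1) and C = assms(2-4)
  have proper: "proper_fun f" and lsc: "lsc_fun f"
    using f by (auto simp: legendre_type_def)
  have dom: "x \<in> edom f" if min: "is_minimizer ?F x" for x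
  proof (rule ccontr)
    assume "x \<notin> edom f"
    then have "?F x = \<infinity>" using right_farthest_dist_outside_edom proper C by blast
    moreover obtain c where c: "c \<in> edom f" using C interior_subset by blast
    ultimately show False
      using min right_farthest_points_compact_nonempty(3)[OF f C c] by (metis is_minimizer_def ereal_infty_less_eq(1))
  qed
  obtain x0 where x0: "is_minimizer ?F x0"
    using right_farthest_dist_has_minimizer[OF f C] by blast
  have "x = x0" if "is_minimizer ?F x" for x
  proof (rule ccontr)
    assume ne: "x \<noteq> x0"
    obtain u where "u \<in> convex hull (grad f ` ?Q x0)" "u \<in> subdiff f x0"
      using minimizer_imp_common_subgradient[OF f C dom[OF x0] x0] by blast
    then have "?F x0 < ?F x"
      using right_farthest_dist_strict_min[OF f C dom[OF x0]] ne by blast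
    then show False using that by (simp add: is_minimizer_def leD)
  qed
  with x0 have "\<exists>!x. is_minimizer ?F x" by blast
  moreover have "is_minimizer ?F x \<longleftrightarrow>
      x \<in> grad (fenchel_conj f) ` (convex hull (grad f ` ?Q x))" if x: "x \<in> edom f" for x
  proof
    assume "is_minimizer ?F x"
    then show "x \<in> grad (fenchel_conj f) ` (convex hull (grad f ` ?Q x))"
      using minimizer_imp_common_subgradient[OF f C x] grad_fenchel_conj[OF f] by (metis image_eqI)
  next
    assume "x \<in> grad (fenchel_conj f) ` (convex hull (grad f ` ?Q x))"
    then obtain u where u: "u \<in> convex hull (grad f ` ?Q x)" and xu: "x = grad (fenchel_conj f) u"
      by blast
    have "grad f ` ?Q x \<subseteq> coercive_slopes f"
      using C(3) subdiff_coercive_slopes[OF f] grad_in_subdiff[OF f]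
      by (auto simp: right_farthest_points_def)
    then have "u \<in> coercive_slopes f"
      using u hull_minimal[of _ "coercive_slopes f" convex] convex_coercive_slopes by blast
    then obtain z where z: "u \<in> subdiff f z"
      using coercive_slope_in_subdiff[OF lsc proper] by blast
    then have "u \<in> subdiff f x" using xu grad_fenchel_conj[OF f z] by simp
    then have "?F x < ?F y" if "y \<noteq> x" for y
      using right_farthest_dist_strict_min[OF f C x u _ that] by blast
    then show "is_minimizer ?F x" unfolding is_minimizer_def by (metis less_imp_le order_refl)
  qed
  ultimately show ?thesis using dom by blast
qed

end
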